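(* Let $R$ be a nonzero commutative ring with identity that is not an integral domain. If every vertex of $\mathbb{AG}(R)$ is a prime ideal of $R$ (i.e. $\mathbb{A}(R)^*\subseteq \mathrm{Spec}(R)$), then either $R\cong F_1\oplus F_2$ (direct product of rings) for a pair of fields $F_1$ and $F_2$, or $R$ has only one nonzero proper ideal.
   Context: An ideal $I$ of a commutative ring $R$ is called an annihilating-ideal if there exists a nonzero ideal $J$ of $R$ with $IJ=(0)$. $\mathbb{A}(R)$ denotes the set of all annihilating-ideals of $R$, and $\mathbb{A}(R)^*=\mathbb{A}(R)\setminus\{(0)\}$. The annihilating-ideal graph $\mathbb{AG}(R)$ is the undirected graph with vertex set $\mathbb{A}(R)^*$ in which two distinct vertices $I,J$ are adjacent if and only if $IJ=(0)$. "Only one nonzero proper ideal" means exactly one. *)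

theory Defs
  imports "HOL-Algebra.Algebra" "Graph_Theory.Pair_Digraph"
begin

definition annihilating_ideals :: "('a, 'b) ring_scheme \<Rightarrow> 'a set set"
  where "annihilating_ideals R =
    {I. ideal I R \<and> (\<exists>J. ideal J R \<and> J \<noteq> {\<zero>\<^bsub>R\<^esub>} \<and> ideal_prod R I J = {\<zero>\<^bsub>R\<^esub>})}"

text \<open>An undirected edge is represented by its two opposite arcs; the arc relation is
  symmetric because the ring is commutative (lemma \<open>annihilating_ideal_graph_sym\<close>).\<close>

definition annihilating_ideal_graph :: "('a, 'b) ring_scheme \<Rightarrow> 'a set pair_pre_digraph"
  where "annihilating_ideal_graph R =
    \<lparr> pverts = annihilating_ideals R - {{\<zero>\<^bsub>R\<^esub>}},
      parcs = {(I, J). I \<in> annihilating_ideals R - {{\<zero>\<^bsub>R\<^esub>}} \<and>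
                       J \<in> annihilating_ideals R - {{\<zero>\<^bsub>R\<^esub>}} \<and>
                       I \<noteq> J \<and> ideal_prod R I J = {\<zero>\<^bsub>R\<^esub>}} \<rparr>"

lemma annihilating_ideal_graph_sym:
  assumes "cring R"
  shows "sym (parcs (annihilating_ideal_graph R))"
  using cring.ideal_prod_commute[OF assms]
  by (auto simp: sym_def annihilating_ideal_graph_def annihilating_ideals_def)

end

theory Submission
  imports Defs
begin

text \<open>If some nonzero zero divisor \<open>x\<close> is not nilpotent of order two, then \<open>x\<^sup>2\<close> generates a
  prime ideal, so \<open>x \<in> R x\<^sup>2\<close> and \<open>R\<close> has a nontrivial idempotent \<open>e\<close>. Every nonzero \<open>y \<in> R e\<close> is
  killed by \<open>1 - e\<close>, so \<open>R y\<close> is prime; it contains \<open>e (1 - e) = 0\<close> but not \<open>1 - e\<close>, hence \<open>e \<in> R y\<close>, and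
  \<open>y\<close> is a unit of \<open>R e\<close>. So \<open>R = R e \<times> R (1 - e)\<close> is a product of two fields.
  Otherwise all zero divisors square to zero, hence lie in each prime ideal \<open>R x\<close> with \<open>x\<close> a
  nonzero zero divisor. So any such \<open>x\<close> generates the ideal \<open>M\<close> of all zero divisors, and every
  \<open>y \<notin> M\<close> is a unit because \<open>x \<in> R x y\<close> gives \<open>(1 - r y)\<^sup>2 = 0\<close>.\<close>

text \<open>The identity is \<open>e\<close>, so this is in general not a subring of
  \<open>R\<close>. Being a plain \<open>ring\<close> record, without the extension fields of
  \<open>R\<close>, it can serve as a factor of type \<open>'a ring\<close>.\<close>

definition corner_ring :: "('a, 'b) ring_scheme \<Rightarrow> 'a \<Rightarrow> 'a ring"
  where "corner_ring R e =
    \<lparr> carrier = PIdl\<^bsub>R\<^esub> e, monoid.mult = (\<otimes>\<^bsub>R\<^esub>), one = e, ring.zero = \<zero>\<^bsub>R\<^esub>, ring.add = (\<oplus>\<^bsub>R\<^esub>) \<rparr>"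

section \<open>Principal ideals and the decomposition along an idempotent\<close>

context cring
begin

lemma mem_cgenideal_iff: "x \<in> PIdl a \<longleftrightarrow> (\<exists>r\<in>carrier R. x = r \<otimes> a)"
  by (auto simp: cgenideal_def)

text \<open>Multiplication by an idempotent fixes each multiple \<open>r \<otimes> e\<close>, so
  membership turns into an equation.\<close>

lemma mem_cgenideal_idem_iff:
  assumes "e \<in> carrier R" "e \<otimes> e = e"
  shows "x \<in> PIdl e \<longleftrightarrow> x \<in> carrier R \<and> x \<otimes> e = x"
  using assms by (metis m_assoc m_closed mem_cgenideal_iff)

lemma cgenideal_nonzero:
  assumes "a \<in> carrier R" "a \<noteq> \<zero>"
  shows "PIdl a \<noteq> {\<zero>}"
  using assms cgenideal_self by blast

lemma corner_ring_cring:
  assumes e: "e \<in> carrier R" "e \<otimes> e = e"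
  shows "cring (corner_ring R e)"
proof -
  note mem = mem_cgenideal_idem_iff[OF e]
  have left: "e \<otimes> x = x" if "x \<in> carrier R" "x \<otimes> e = x" for x
    using that e by (metis m_comm)
  show ?thesis
  proof (intro cringI abelian_groupI comm_monoidI)
    fix x assume "x \<in> carrier (corner_ring R e)"
    then have "\<ominus> x \<in> PIdl e" "\<ominus> x \<oplus> x = \<zero>"
      using e by (auto simp: corner_ring_def mem l_neg l_minus)
    then show "\<exists>y\<in>carrier (corner_ring R e). y \<oplus>\<^bsub>corner_ring R e\<^esub> x = \<zero>\<^bsub>corner_ring R e\<^esub>"
      by (auto simp: corner_ring_def)
  next
    fix x y assume "x \<in> carrier (corner_ring R e)" "y \<in> carrier (corner_ring R e)"
    then show "x \<otimes>\<^bsub>corner_ring R e\<^esub> y = y \<otimes>\<^bsub>corner_ring R e\<^esub> x"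
      by (auto simp: corner_ring_def mem intro!: m_comm)
  qed (use e in \<open>auto simp: corner_ring_def mem left a_ac m_assoc l_distr\<close>)
qed

text \<open>The Peirce decomposition: \<open>x\<close> goes to
  \<open>(x \<otimes> e, x \<otimes> f)\<close>, and addition of the components is the inverse.
  Injectivity comes from \<open>e \<oplus> f = \<one>\<close>, surjectivity from
  \<open>e \<otimes> f = \<zero>\<close>.\<close>

lemma idempotent_decomposition:
  assumes e: "e \<in> carrier R" "e \<otimes> e = e"
    and f: "f \<in> carrier R" "f \<otimes> f = f"
    and ef: "e \<otimes> f = \<zero>" "e \<oplus> f = \<one>"
  shows "R \<simeq> RDirProd (corner_ring R e) (corner_ring R f)"
proof -
  note mem = mem_cgenideal_idem_iff[OF e] mem_cgenideal_idem_iff[OF f]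
  have fe: "f \<otimes> e = \<zero>"
    using e f ef by (simp add: m_comm)
  have split: "x \<otimes> e \<oplus> x \<otimes> f = x" if "x \<in> carrier R" for x
    using that e f ef by (metis r_distr r_one)
  define h where "h x = (x \<otimes> e, x \<otimes> f)" for x
  have mult: "x \<otimes> y \<otimes> g = x \<otimes> g \<otimes> (y \<otimes> g)"
    if "x \<in> carrier R" "y \<in> carrier R" "g \<in> carrier R" "g \<otimes> g = g" for x y g
    using that by (metis m_assoc m_closed m_comm)
  have closed: "x \<otimes> g \<in> PIdl g" if "x \<in> carrier R" for x g
    using that by (auto simp: mem_cgenideal_iff)
  have hom: "h \<in> ring_hom R (RDirProd (corner_ring R e) (corner_ring R f))"
    by (rule ring_hom_memI)
      (use e f in \<open>auto simp: h_def RDirProd_def DirProd_def monoid.defs corner_ring_def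
        closed l_distr intro: mult\<close>)
  have "inj_on h (carrier R)"
    by (rule inj_onI) (metis h_def prod.inject split)
  moreover have "h ` carrier R = carrier (RDirProd (corner_ring R e) (corner_ring R f))"
  proof
    show "h ` carrier R \<subseteq> carrier (RDirProd (corner_ring R e) (corner_ring R f))"
      using hom by (auto simp: ring_hom_def)
    show "carrier (RDirProd (corner_ring R e) (corner_ring R f)) \<subseteq> h ` carrier R"
    proof
      fix p assume "p \<in> carrier (RDirProd (corner_ring R e) (corner_ring R f))"
      then obtain x y where p: "p = (x, y)"
        and x: "x \<in> carrier R" "x \<otimes> e = x" and y: "y \<in> carrier R" "y \<otimes> f = y"
        by (auto simp: RDirProd_carrier corner_ring_def mem)
      have "x \<otimes> f = \<zero>" "y \<otimes> e = \<zero>"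
        using x y e f ef fe by (metis m_assoc r_null)+
      then have "h (x \<oplus> y) = p"
        using x y e f p by (simp add: h_def l_distr)
      then show "p \<in> h ` carrier R"
        using x y by force
    qed
  qed
  ultimately have "h \<in> ring_iso R (RDirProd (corner_ring R e) (corner_ring R f))"
    using hom by (simp add: ring_iso_def bij_betw_def)
  then show ?thesis
    by (auto simp: is_ring_iso_def)
qed

text \<open>The annihilating partner of \<open>PIdl x\<close> is \<open>PIdl c\<close>: products of
  their elements are multiples of \<open>x \<otimes> c\<close>, and sums of such products vanish
  too.\<close>

lemma cgenideal_annihilating:
  assumes x: "x \<in> carrier R" and c: "c \<in> carrier R" "c \<noteq> \<zero>" "x \<otimes> c = \<zero>"
  shows "PIdl x \<in> annihilating_ideals R"
proof -
  have zero: "y \<otimes> z = \<zero>" if y: "y \<in> PIdl x" and z: "z \<in> PIdl c" for y z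
  proof -
    obtain r s where "r \<in> carrier R" "y = r \<otimes> x" "s \<in> carrier R" "z = s \<otimes> c"
      using y z by (auto simp: mem_cgenideal_iff)
    then have "y \<otimes> z = r \<otimes> s \<otimes> (x \<otimes> c)"
      using x c(1) by (simp add: m_assoc m_lcomm)
    then show ?thesis
      using \<open>r \<in> carrier R\<close> \<open>s \<in> carrier R\<close> c by simp
  qed
  have "s = \<zero>" if s: "s \<in> ideal_prod R (PIdl x) (PIdl c)" for s
    using s by (induction rule: ideal_prod.induct) (auto simp: zero)
  moreover have "\<zero> \<in> ideal_prod R (PIdl x) (PIdl c)"
    using ideal_prod.prod[OF cgenideal_self[OF x] cgenideal_self[OF c(1)], of R] c by simp
  ultimately have "ideal_prod R (PIdl x) (PIdl c) = {\<zero>}"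
    by blast
  then show ?thesis
    unfolding annihilating_ideals_def
    using cgenideal_ideal[OF x] cgenideal_ideal[OF c(1)] cgenideal_nonzero[OF c(1,2)] by blast
qed

section \<open>The two cases: a nontrivial idempotent, or zero divisors of square zero\<close>

text \<open>In the application, \<open>f\<close> is \<open>1 - e\<close>.\<close>

lemma corner_ring_field:
  assumes prime: "\<And>x c. \<lbrakk>x \<in> carrier R; x \<noteq> \<zero>; c \<in> carrier R; c \<noteq> \<zero>; x \<otimes> c = \<zero>\<rbrakk>
      \<Longrightarrow> primeideal (PIdl x) R"
    and e: "e \<in> carrier R" "e \<otimes> e = e" "e \<noteq> \<zero>"
    and f: "f \<in> carrier R" "f \<otimes> f = f" "f \<noteq> \<zero>"
    and ef: "e \<otimes> f = \<zero>"
  shows "field (corner_ring R e)"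
proof (rule cring.cring_fieldI2)
  note mem = mem_cgenideal_idem_iff[OF e(1,2)]
  show "cring (corner_ring R e)"
    using e(1,2) by (rule corner_ring_cring)
  show "\<zero>\<^bsub>corner_ring R e\<^esub> \<noteq> \<one>\<^bsub>corner_ring R e\<^esub>"
    using e by (simp add: corner_ring_def)
  fix y assume "y \<in> carrier (corner_ring R e)" "y \<noteq> \<zero>\<^bsub>corner_ring R e\<^esub>"
  then have y: "y \<in> carrier R" "y \<otimes> e = y" "y \<noteq> \<zero>"
    by (auto simp: corner_ring_def mem)
  have yf: "y \<otimes> f = \<zero>"
    using m_assoc[OF y(1) e(1) f(1)] y ef by simp
  interpret P: primeideal "PIdl y" R
    using prime[OF y(1,3) f(1,3) yf] .
  \<comment> \<open>\<open>f\<close> annihilates all of \<open>PIdl y\<close>, but not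
    itself.\<close>
  have "f \<notin> PIdl y"
  proof
    assume "f \<in> PIdl y"
    then obtain r where "r \<in> carrier R" "f = r \<otimes> y"
      by (auto simp: mem_cgenideal_iff)
    then have "f \<otimes> f = \<zero>"
      using m_assoc[of r y f] y(1) f(1) yf by simp
    then show False
      using f by simp
  qed
  moreover have "e \<otimes> f \<in> PIdl y"
    using ef by simp
  ultimately obtain r where r: "r \<in> carrier R" "e = r \<otimes> y"
    using P.I_prime[OF e(1) f(1)] by (auto simp: mem_cgenideal_iff)
  \<comment> \<open>The inverse is \<open>r \<otimes> e\<close>, since \<open>r\<close> itself may
    lie outside the corner.\<close>
  have "y \<otimes> (r \<otimes> e) = e"
    using r(1) r(2)[symmetric] y e(1) by (simp add: m_lcomm)
  moreover have "r \<otimes> e \<in> PIdl e"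
    using r by (auto simp: mem_cgenideal_iff)
  ultimately show "\<exists>b\<in>carrier (corner_ring R e).
      y \<otimes>\<^bsub>corner_ring R e\<^esub> b = \<one>\<^bsub>corner_ring R e\<^esub>"
    by (auto simp: corner_ring_def)
qed

text \<open>With \<open>x\<close> also \<open>x \<otimes> x\<close> is killed by \<open>c\<close>,
  so it generates a prime ideal, which must contain \<open>x\<close>. The quotient of
  \<open>x\<close> by \<open>x \<otimes> x\<close> then yields the idempotent.\<close>

lemma product_of_fields_if_zero_divisor_square_nonzero:
  assumes prime: "\<And>x c. \<lbrakk>x \<in> carrier R; x \<noteq> \<zero>; c \<in> carrier R; c \<noteq> \<zero>; x \<otimes> c = \<zero>\<rbrakk>
      \<Longrightarrow> primeideal (PIdl x) R"
    and x: "x \<in> carrier R" "x \<otimes> x \<noteq> \<zero>"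
    and c: "c \<in> carrier R" "c \<noteq> \<zero>" "x \<otimes> c = \<zero>"
  shows "\<exists>(F1 :: 'a ring) (F2 :: 'a ring). field F1 \<and> field F2 \<and> R \<simeq> RDirProd F1 F2"
proof -
  have "x \<otimes> x \<otimes> c = \<zero>"
    using x c by (simp add: m_assoc)
  then interpret P: primeideal "PIdl (x \<otimes> x)" R
    using prime[of "x \<otimes> x" c] x c by simp
  have "x \<in> PIdl (x \<otimes> x)"
    using P.I_prime[OF x(1) x(1)] cgenideal_self x(1) by simp
  then obtain r where r: "r \<in> carrier R" "x = r \<otimes> (x \<otimes> x)"
    by (auto simp: mem_cgenideal_iff)
  \<comment> \<open>The relation \<open>x = r \<otimes> (x \<otimes> x)\<close> says that
    \<open>e\<close> fixes \<open>x\<close>, hence also its own multiple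
    \<open>r \<otimes> x\<close>.\<close>
  define e where "e = r \<otimes> x"
  define f where "f = \<one> \<ominus> e"
  have e: "e \<in> carrier R"
    using r(1) x(1) by (simp add: e_def)
  have ex: "e \<otimes> x = x"
    using r(1) r(2)[symmetric] x(1) by (simp add: e_def m_assoc)
  have ee: "e \<otimes> e = e"
    using m_lcomm[OF e r(1) x(1)] ex by (simp add: e_def)
  have e0: "e \<noteq> \<zero>"
    using ex x by auto
  have f: "f \<in> carrier R"
    using e by (simp add: f_def)
  have ef: "e \<otimes> f = \<zero>"
    using e ee by (simp add: f_def minus_eq r_distr r_minus r_neg)
  have sum: "e \<oplus> f = \<one>"
    using e by (simp add: f_def minus_eq a_lcomm[of e] r_neg)
  have ff: "f \<otimes> f = f"
    using l_distr[OF e f f] e f ef sum by simp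
  have ec: "e \<otimes> c = \<zero>"
    using r(1) x(1) c by (simp add: e_def m_assoc)
  \<comment> \<open>Otherwise \<open>e\<close> would be \<open>\<one>\<close>, although it kills the
    nonzero \<open>c\<close>.\<close>
  have f0: "f \<noteq> \<zero>"
    using ec sum c e by auto
  have fe: "f \<otimes> e = \<zero>"
    using m_comm[OF f e] ef by simp
  have "field (corner_ring R e)"
    by (rule corner_ring_field) (fact prime e ee e0 f ff f0 ef)+
  moreover have "field (corner_ring R f)"
    by (rule corner_ring_field) (fact prime e ee e0 f ff f0 fe)+
  moreover have "R \<simeq> RDirProd (corner_ring R e) (corner_ring R f)"
    by (rule idempotent_decomposition) fact+
  ultimately show ?thesis
    by blast
qed

text \<open>Any two nonzero zero divisors generate the same ideal, and elements outside it are
  units. So \<open>R\<close> is local, and its maximal ideal is generated by each of its nonzero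
  elements.\<close>

lemma unique_ideal_if_zero_divisors_square_zero:
  assumes prime: "\<And>x c. \<lbrakk>x \<in> carrier R; x \<noteq> \<zero>; c \<in> carrier R; c \<noteq> \<zero>; x \<otimes> c = \<zero>\<rbrakk>
      \<Longrightarrow> primeideal (PIdl x) R"
    and square: "\<And>x c. \<lbrakk>x \<in> carrier R; c \<in> carrier R; c \<noteq> \<zero>; x \<otimes> c = \<zero>\<rbrakk> \<Longrightarrow> x \<otimes> x = \<zero>"
    and x: "x \<in> carrier R" "x \<noteq> \<zero>"
    and c: "c \<in> carrier R" "c \<noteq> \<zero>" "x \<otimes> c = \<zero>"
  shows "\<exists>!I. ideal I R \<and> I \<noteq> {\<zero>} \<and> I \<noteq> carrier R"
proof -
  \<comment> \<open>The prime ideal \<open>PIdl y\<close> contains \<open>z \<otimes> z\<close>,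
    which is zero.\<close>
  have sub: "z \<in> PIdl y"
    if y: "y \<in> carrier R" "y \<noteq> \<zero>" "y \<otimes> y = \<zero>"
      and z: "z \<in> carrier R" "d \<in> carrier R" "d \<noteq> \<zero>" "z \<otimes> d = \<zero>" for y z d
  proof -
    interpret P: primeideal "PIdl y" R
      using prime[OF y(1,2) y(1,2,3)] .
    have "z \<otimes> z \<in> PIdl y"
      using square z by simp
    then show ?thesis
      using P.I_prime[OF z(1) z(1)] by blast
  qed
  have xx: "x \<otimes> x = \<zero>"
    using square x c by blast
  interpret M: primeideal "PIdl x" R
    using prime[OF x c] .
  have unit: "\<exists>u\<in>carrier R. u \<otimes> y = \<one>" if y: "y \<in> carrier R" "y \<notin> PIdl x" for y
  proof -
    \<comment> \<open>Otherwise \<open>y\<close> would be a zero divisor and lie in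
      \<open>PIdl x\<close> by \<open>sub\<close>.\<close>
    have "x \<otimes> y \<noteq> \<zero>"
      using sub[OF x xx y(1) x] y(2) m_comm[OF x(1) y(1)] by auto
    moreover have "x \<otimes> y \<otimes> (x \<otimes> y) = \<zero>"
    proof -
      have "x \<otimes> y \<otimes> (x \<otimes> y) = x \<otimes> x \<otimes> (y \<otimes> y)"
        using x(1) y(1) by (simp add: m_assoc m_lcomm)
      then show ?thesis
        using y(1) xx by simp
    qed
    ultimately have "x \<in> PIdl (x \<otimes> y)"
      using sub[of "x \<otimes> y", OF _ _ _ x(1) c] x(1) y(1) by simp
    then obtain r where r: "r \<in> carrier R" "x = r \<otimes> (x \<otimes> y)"
      by (auto simp: mem_cgenideal_iff)
    \<comment> \<open>\<open>n\<close> kills \<open>x\<close>, so it squares to zero, and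
      \<open>\<one> \<oplus> n\<close> inverts
      \<open>r \<otimes> y = \<one> \<ominus> n\<close>.\<close>
    define n where "n = \<one> \<ominus> r \<otimes> y"
    have n: "n \<in> carrier R"
      using r(1) y(1) by (simp add: n_def)
    have "x \<otimes> (r \<otimes> y) = x"
      using m_lcomm[OF x(1) r(1) y(1)] r(2) by simp
    then have "x \<otimes> n = \<zero>"
      using r(1) x(1) y(1) by (simp add: n_def minus_eq r_distr r_minus r_neg)
    then have "n \<otimes> x = \<zero>"
      using m_comm[OF n x(1)] by simp
    then have nn: "n \<otimes> n = \<zero>"
      using square[OF n x] by simp
    have sum: "r \<otimes> y \<oplus> n = \<one>"
      using r(1) y(1) by (simp add: n_def minus_eq a_lcomm[of "r \<otimes> y"] r_neg)
    have "n \<otimes> (r \<otimes> y) = n"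
      using r_distr[of "r \<otimes> y" n n] n nn r(1) y(1) sum by simp
    then have "(\<one> \<oplus> n) \<otimes> (r \<otimes> y) = \<one>"
      using n r(1) y(1) sum by (simp add: l_distr)
    then have "(\<one> \<oplus> n) \<otimes> r \<otimes> y = \<one>"
      using n r(1) y(1) by (simp add: m_assoc)
    then show ?thesis
      using n r(1) by blast
  qed
  show ?thesis
  proof (rule ex1I)
    show "ideal (PIdl x) R \<and> PIdl x \<noteq> {\<zero>} \<and> PIdl x \<noteq> carrier R"
      using M.is_ideal M.I_notcarr cgenideal_nonzero x by blast
  next
    fix I assume I: "ideal I R \<and> I \<noteq> {\<zero>} \<and> I \<noteq> carrier R"
    then interpret I: ideal I R
      by simp
    have "I \<subseteq> PIdl x"
    proof
      fix y assume y: "y \<in> I"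
      show "y \<in> PIdl x"
      proof (rule ccontr)
        assume "y \<notin> PIdl x"
        then have "\<one> \<in> I"
          using unit[OF I.Icarr[OF y]] I.I_l_closed[OF y] by metis
        then show False
          using I I.one_imp_carrier by blast
      qed
    qed
    moreover obtain y where y: "y \<in> I" "y \<noteq> \<zero>"
      using I I.zero_closed by blast
    \<comment> \<open>As a multiple of \<open>x\<close>, the element \<open>y\<close> is itself a
      zero divisor, so \<open>sub\<close> applies with the roles of \<open>x\<close> and
      \<open>y\<close> exchanged.\<close>
    moreover have "y \<otimes> x = \<zero>"
    proof -
      obtain r where "r \<in> carrier R" "y = r \<otimes> x"
        using calculation mem_cgenideal_iff by blast
      then show ?thesis
        using x xx by (simp add: m_assoc)
    qed
    then have "x \<in> PIdl y"
      using sub[OF I.Icarr[OF y(1)] y(2) _ x(1) c] square[OF I.Icarr[OF y(1)] x] by simp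
    then have "x \<in> I"
      using I.I_l_closed[OF y(1)] by (auto simp: mem_cgenideal_iff)
    then have "PIdl x \<subseteq> I"
      using I.is_ideal by (rule cgenideal_minimal[rotated])
    ultimately show "I = PIdl x"
      by blast
  qed
qed

end

theorem theorem2p10:
  fixes R :: "('a, 'b) ring_scheme"
  assumes "cring R"
    and "carrier R \<noteq> {\<zero>\<^bsub>R\<^esub>}"
    and "\<not> domain R"
    and "\<forall>I \<in> pverts (annihilating_ideal_graph R). primeideal I R"
  shows "(\<exists>(F1 :: 'a ring) (F2 :: 'a ring). field F1 \<and> field F2 \<and> R \<simeq> RDirProd F1 F2)
       \<or> (\<exists>!I. ideal I R \<and> I \<noteq> {\<zero>\<^bsub>R\<^esub>} \<and> I \<noteq> carrier R)"
proof -
  interpret cring R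
    by fact
  \<comment> \<open>\<open>PIdl x\<close> is a vertex of the graph; this turns the hypothesis on
    vertices into one on zero divisors.\<close>
  have prime: "primeideal (PIdl\<^bsub>R\<^esub> x) R"
    if "x \<in> carrier R" "x \<noteq> \<zero>\<^bsub>R\<^esub>" "c \<in> carrier R" "c \<noteq> \<zero>\<^bsub>R\<^esub>" "x \<otimes>\<^bsub>R\<^esub> c = \<zero>\<^bsub>R\<^esub>" for x c
    using assms(4) that cgenideal_annihilating cgenideal_nonzero
    by (auto simp: annihilating_ideal_graph_def)
  have "\<one>\<^bsub>R\<^esub> \<noteq> \<zero>\<^bsub>R\<^esub>"
    using assms(2) carrier_one_zero by auto
  then obtain x c where xc: "x \<in> carrier R" "x \<noteq> \<zero>\<^bsub>R\<^esub>" "c \<in> carrier R" "c \<noteq> \<zero>\<^bsub>R\<^esub>"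
      "x \<otimes>\<^bsub>R\<^esub> c = \<zero>\<^bsub>R\<^esub>"
    using assms(1,3) by (auto simp: domain_def domain_axioms_def)
  show ?thesis
  \<comment> \<open>The condition \<open>x \<otimes> x \<noteq> \<zero>\<close> already forces
    \<open>x\<close> to be nonzero.\<close>
  proof (cases "\<exists>x\<in>carrier R. \<exists>c\<in>carrier R.
      c \<noteq> \<zero>\<^bsub>R\<^esub> \<and> x \<otimes>\<^bsub>R\<^esub> c = \<zero>\<^bsub>R\<^esub> \<and> x \<otimes>\<^bsub>R\<^esub> x \<noteq> \<zero>\<^bsub>R\<^esub>")
    case True
    then obtain y d where yd: "y \<in> carrier R" "y \<otimes>\<^bsub>R\<^esub> y \<noteq> \<zero>\<^bsub>R\<^esub>"
        "d \<in> carrier R" "d \<noteq> \<zero>\<^bsub>R\<^esub>" "y \<otimes>\<^bsub>R\<^esub> d = \<zero>\<^bsub>R\<^esub>"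
      by blast
    show ?thesis
      by (rule disjI1, rule product_of_fields_if_zero_divisor_square_nonzero[OF _ yd]) (fact prime)
  next
    case False
    then have square: "y \<otimes>\<^bsub>R\<^esub> y = \<zero>\<^bsub>R\<^esub>"
      if "y \<in> carrier R" "d \<in> carrier R" "d \<noteq> \<zero>\<^bsub>R\<^esub>" "y \<otimes>\<^bsub>R\<^esub> d = \<zero>\<^bsub>R\<^esub>" for y d
      using that by blast
    show ?thesis
      by (rule disjI2, rule unique_ideal_if_zero_divisors_square_zero[OF _ _ xc]) (fact prime square)+
  qed
qed

end
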